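(* Let $k$ be a positive integer, let $G$ be a balanced bipartite graph of order $2n$, and let $M$ be a perfect matching of $G$, where $n \ge 12k-9$. If $\sigma_{1,1}(G) \ge n+2$, then $G$ contains $k$ vertex-disjoint $M$-cycles, each of length $6$ or $8$.
   Context: Graphs are finite and simple. For a bipartite graph $G$ with partite sets $X,Y$, $\sigma_{1,1}(G) = \min\{d_G(x)+d_G(y) : x \in X, y \in Y, xy \notin E(G)\}$ if $G$ is not complete bipartite, and $+\infty$ otherwise. For a matching $M$, a cycle $C$ of $G$ is an $M$-cycle if $|E(C)\cap M| = |C|/2$, i.e. $C$ alternates between edges of $M$ and edges not in $M$. *)

theory Defs
  imports Main "HOL-Library.Extended_Nat"
begin

definition bipartite_graph :: "'a set \<Rightarrow> 'a set \<Rightarrow> 'a set set \<Rightarrow> bool" where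
  "bipartite_graph X Y E \<longleftrightarrow> finite X \<and> finite Y \<and> X \<inter> Y = {} \<and>
     E \<subseteq> {{x, y} | x y. x \<in> X \<and> y \<in> Y}"

definition degree :: "'a set set \<Rightarrow> 'a \<Rightarrow> nat" where
  "degree E v = card {u. {v, u} \<in> E}"

text \<open>sigma_{1,1}: minimum of d(x)+d(y) over non-adjacent pairs x in X, y in Y;
  infinity (Inf of the empty set) if G is complete bipartite.\<close>
definition sigma11 :: "'a set \<Rightarrow> 'a set \<Rightarrow> 'a set set \<Rightarrow> enat" where
  "sigma11 X Y E = (INF p \<in> {(x, y). x \<in> X \<and> y \<in> Y \<and> {x, y} \<notin> E}.
                      enat (degree E (fst p) + degree E (snd p)))"

definition perfect_matching :: "'a set \<Rightarrow> 'a set set \<Rightarrow> 'a set set \<Rightarrow> bool" where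
  "perfect_matching V E M \<longleftrightarrow> M \<subseteq> E \<and> (\<forall>v\<in>V. \<exists>!e. e \<in> M \<and> v \<in> e)"

definition cycle_edges :: "'a list \<Rightarrow> 'a set set" where
  "cycle_edges C = {{C ! i, C ! ((i + 1) mod length C)} | i. i < length C}"

definition is_cycle :: "'a set set \<Rightarrow> 'a list \<Rightarrow> bool" where
  "is_cycle E C \<longleftrightarrow> length C \<ge> 3 \<and> distinct C \<and> cycle_edges C \<subseteq> E"

definition is_M_cycle :: "'a set set \<Rightarrow> 'a set set \<Rightarrow> 'a list \<Rightarrow> bool" where
  "is_M_cycle E M C \<longleftrightarrow> is_cycle E C \<and> 2 * card (cycle_edges C \<inter> M) = length C"

end

theory Submission
  imports Defs
begin

text \<open>Contracting the matching \<open>M\<close> turns \<open>G\<close> into a digraph on \<open>X\<close> with an arc from \<open>x\<close> to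
  \<open>x'\<close> whenever \<open>x\<close> is adjacent to the partner of \<open>x'\<close>. The \<open>M\<close>-cycles of length 6 and 8 become
  directed cycles of length 3 and 4, and the hypothesis becomes
  \<open>d\<^sup>+(u) + d\<^sup>-(v) \<ge> n\<close> whenever \<open>u \<noteq> v\<close> and there is no arc from \<open>u\<close> to \<open>v\<close>.

  Suppose a maximal packing has fewer than \<open>k\<close> cycles, and prefer triangles to 4-cycles. Let \<open>r\<close> be
  the number of its triangles and \<open>H\<close> the digraph of uncovered vertices. If \<open>u \<rightarrow> v\<close> is an arc of
  \<open>H\<close> whose reverse is missing, then \<open>N\<^sup>+(v)\<close> and \<open>N\<^sup>-(u)\<close> are disjoint with no arc from the first
  to the second, and vertices of low degree inside them give
  \<open>d\<^sup>+(v) + d\<^sup>-(u) \<le> |H| - r - 3\<close> in \<open>H\<close>. So many arcs join \<open>u, v\<close> to the packing that three disjoint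
  such arcs would allow to exchange a triangle for two, or a 4-cycle for a triangle. Hence a few
  vertices meet all of them, and away from these \<open>H\<close> is an undirected graph of girth at least 5,
  which is too sparse for the degree condition.\<close>

section \<open>Degrees and short directed cycles in digraphs\<close>

definition outdeg :: "('a \<Rightarrow> 'a \<Rightarrow> bool) \<Rightarrow> 'a \<Rightarrow> 'a set \<Rightarrow> nat" where
  "outdeg R u A = card {w \<in> A. R u w}"

abbreviation indeg :: "('a \<Rightarrow> 'a \<Rightarrow> bool) \<Rightarrow> 'a \<Rightarrow> 'a set \<Rightarrow> nat" where
  "indeg R \<equiv> outdeg R\<inverse>\<inverse>"

text \<open>Cycles are recorded by their vertex sets only, since a packing and the exchange
  arguments depend on nothing else.\<close>

definition dicycle3 :: "('a \<Rightarrow> 'a \<Rightarrow> bool) \<Rightarrow> 'a set \<Rightarrow> bool" where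
  "dicycle3 R C \<longleftrightarrow> (\<exists>a b c. C = {a, b, c} \<and> distinct [a, b, c] \<and> R a b \<and> R b c \<and> R c a)"

definition dicycle4 :: "('a \<Rightarrow> 'a \<Rightarrow> bool) \<Rightarrow> 'a set \<Rightarrow> bool" where
  "dicycle4 R C \<longleftrightarrow>
     (\<exists>a b c d. C = {a, b, c, d} \<and> distinct [a, b, c, d] \<and> R a b \<and> R b c \<and> R c d \<and> R d a)"

definition packing :: "('a \<Rightarrow> 'a \<Rightarrow> bool) \<Rightarrow> 'a set \<Rightarrow> 'a set set \<Rightarrow> bool" where
  "packing R V F \<longleftrightarrow> F \<subseteq> Pow V \<and> pairwise disjnt F \<and> (\<forall>C\<in>F. dicycle3 R C \<or> dicycle4 R C)"

text \<open>A triangle counts 2 and a 4-cycle counts 1; packed sets have 3 or 4 elements, so the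
  subtraction never truncates on a packing.\<close>

definition weight :: "'a set set \<Rightarrow> nat" where
  "weight F = (\<Sum>C\<in>F. 5 - card C)"

lemma card_dicycle3: "dicycle3 R C \<Longrightarrow> card C = 3"
  by (auto simp: dicycle3_def)

lemma card_dicycle4: "dicycle4 R C \<Longrightarrow> card C = 4"
  by (auto simp: dicycle4_def)

lemma outdeg_Un_disjoint:
  assumes "finite A" "finite B" "A \<inter> B = {}"
  shows "outdeg R u (A \<union> B) = outdeg R u A + outdeg R u B"
proof -
  have "{w \<in> A \<union> B. R u w} = {w \<in> A. R u w} \<union> {w \<in> B. R u w}" by auto
  then show ?thesis
    unfolding outdeg_def using assms by (simp add: card_Un_disjoint disjoint_iff)
qed

lemma outdeg_Union:
  assumes "finite F" "\<forall>C\<in>F. finite C" "pairwise disjnt F"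
  shows "outdeg R u (\<Union>F) = (\<Sum>C\<in>F. outdeg R u C)"
proof -
  have "{w \<in> \<Union>F. R u w} = (\<Union>C\<in>F. {w \<in> C. R u w})" by auto
  also have "card \<dots> = (\<Sum>C\<in>F. card {w \<in> C. R u w})"
    using assms by (intro card_UN_disjoint) (auto simp: pairwise_def disjnt_def)
  finally show ?thesis by (simp add: outdeg_def)
qed

lemma outdeg_le_card: "finite A \<Longrightarrow> outdeg R u A \<le> card A"
  unfolding outdeg_def by (intro card_mono) auto

lemma sum_outdeg_eq_sum_indeg:
  assumes "finite A"
  shows "(\<Sum>a\<in>A. outdeg R a A) = (\<Sum>a\<in>A. indeg R a A)"
proof -
  have "(\<Sum>a\<in>A. outdeg R a A) = (\<Sum>a\<in>A. \<Sum>b\<in>A. if R a b then 1 else 0)"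
    unfolding outdeg_def using assms by (simp add: sum.If_cases Int_def)
  also have "\<dots> = (\<Sum>b\<in>A. \<Sum>a\<in>A. if R a b then 1 else 0)" by (rule sum.swap)
  also have "\<dots> = (\<Sum>a\<in>A. indeg R a A)"
    unfolding outdeg_def using assms by (simp add: sum.If_cases Int_def)
  finally show ?thesis .
qed

text \<open>In the absence of triangles an arc \<open>p \<rightarrow> q\<close> has disjoint sets \<open>N\<^sup>+(q)\<close> and
  \<open>N\<^sup>-(p)\<close>; some \<open>p\<close> has at least the average in-degree.\<close>

lemma exists_low_outdeg:
  assumes "finite A" "A \<noteq> {}"
    and tri: "\<And>a b c. \<lbrakk>a \<in> A; b \<in> A; c \<in> A; R a b; R b c; R c a\<rbrakk> \<Longrightarrow> False"
  shows "\<exists>a\<in>A. 2 * outdeg R a A \<le> card A"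
proof (rule ccontr)
  assume "\<not> ?thesis"
  then have hi: "card A < 2 * outdeg R a A" if "a \<in> A" for a using that by force
  have "\<exists>p\<in>A. card A < 2 * indeg R p A"
  proof (rule ccontr)
    assume "\<not> ?thesis"
    then have "(\<Sum>a\<in>A. 2 * indeg R a A) \<le> (\<Sum>a\<in>A. card A)"
      by (intro sum_mono) force
    also have "\<dots> < (\<Sum>a\<in>A. 2 * outdeg R a A)"
      using assms hi by (intro sum_strict_mono) auto
    finally show False
      using sum_outdeg_eq_sum_indeg[OF assms(1), of R] by (simp flip: sum_distrib_left)
  qed
  then obtain p where p: "p \<in> A" "card A < 2 * indeg R p A" by blast
  have "{w \<in> A. R p w} \<noteq> {}"
    using hi[OF p(1)] unfolding outdeg_def by fastforce
  then obtain q where q: "q \<in> A" "R p q" by blast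
  have "outdeg R q A + indeg R p A = card ({w \<in> A. R q w} \<union> {w \<in> A. R w p})"
    unfolding outdeg_def using assms(1) tri[OF p(1) q(1)] q
    by (subst card_Un_disjoint) auto
  also have "\<dots> \<le> card A" using assms(1) by (intro card_mono) auto
  finally show False using hi[OF q(1)] p(2) by simp
qed

section \<open>Digraphs without directed 3-cycles and 4-cycles\<close>

text \<open>Pairs of opposite arcs are allowed, hence the inequalities in \<open>no4\<close>: a
  closed walk of length 4 may run through such pairs. In \<open>no3\<close> irreflexivity already
  makes the three vertices distinct.\<close>

locale short_free =
  fixes R :: "'a \<Rightarrow> 'a \<Rightarrow> bool" and H :: "'a set" and L :: nat
  assumes finite_H: "finite H"
    and irrefl: "\<not> R a a"
    and no3: "\<lbrakk>a \<in> H; b \<in> H; c \<in> H; R a b; R b c; R c a\<rbrakk> \<Longrightarrow> False"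
    and no4: "\<lbrakk>a \<in> H; b \<in> H; c \<in> H; d \<in> H; a \<noteq> c; b \<noteq> d; R a b; R b c; R c d; R d a\<rbrakk> \<Longrightarrow> False"
    and ore: "\<lbrakk>a \<in> H; b \<in> H; a \<noteq> b; \<not> R a b\<rbrakk> \<Longrightarrow> L \<le> outdeg R a H + indeg R b H"

lemma short_free_converse:
  assumes "short_free R H L"
  shows "short_free R\<inverse>\<inverse> H L"
proof -
  interpret short_free R H L by fact
  show ?thesis
  proof
    fix a b c d
    show "finite H" by (rule finite_H)
    show "\<not> R\<inverse>\<inverse> a a" using irrefl by simp
    show False if "a \<in> H" "b \<in> H" "c \<in> H" "R\<inverse>\<inverse> a b" "R\<inverse>\<inverse> b c" "R\<inverse>\<inverse> c a"
      using no3[of c b a] that by simp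
    show False if "a \<in> H" "b \<in> H" "c \<in> H" "d \<in> H" "a \<noteq> c" "b \<noteq> d"
      "R\<inverse>\<inverse> a b" "R\<inverse>\<inverse> b c" "R\<inverse>\<inverse> c d" "R\<inverse>\<inverse> d a"
      using no4[of d c b a] that by auto
    show "L \<le> outdeg R\<inverse>\<inverse> a H + indeg R\<inverse>\<inverse> b H" if "a \<in> H" "b \<in> H" "a \<noteq> b" "\<not> R\<inverse>\<inverse> a b"
      using ore[of b a] that by simp
  qed
qed

text \<open>If \<open>v\<close> has no out-neighbour, \<open>a = v\<close> itself serves as the vertex of small out-degree.\<close>

lemma (in short_free) low_outdeg_beyond_arc:
  assumes uv: "u \<in> H" "v \<in> H" "R u v" "\<not> R v u"
  shows "\<exists>a. (a = v \<or> a \<in> H \<and> R v a) \<and>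
    2 * outdeg R a H + outdeg R v H + 2 * indeg R u H + 2 \<le> 2 * card H"
proof -
  let ?A = "{w \<in> H. R v w}" and ?B = "{w \<in> H. R w u}"
  have AB: "?A \<inter> ?B = {}" using no3 uv by auto
  have fin: "finite ?A" "finite ?B" using finite_H by auto
  have dA: "outdeg R v H = card ?A" and dB: "indeg R u H = card ?B"
    by (auto simp: outdeg_def)
  have sub: "insert u (?A \<union> ?B) \<subseteq> H" "u \<notin> ?A \<union> ?B" using uv irrefl by auto
  then have cardH: "card ?A + card ?B + 1 \<le> card H"
    using card_mono[OF finite_H sub(1)] fin AB by (simp add: card_Un_disjoint)
  show ?thesis
  proof (cases "?A = {}")
    case True
    then have "outdeg R v H = 0" by (simp only: dA) simp
    then show ?thesis using cardH dB by (intro exI[of _ v]) (simp add: True)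
  next
    case False
    then obtain a where a: "a \<in> ?A" "2 * outdeg R a ?A \<le> card ?A"
      using exists_low_outdeg[OF fin(1) False, of R] no3 by auto
    let ?Q = "H - insert u (?A \<union> ?B)"
    \<comment> \<open>An arc from \<open>a\<close> to \<open>u\<close> would close a triangle
      through \<open>u\<close>, \<open>v\<close>, and an arc from \<open>a\<close> into
      \<open>?B\<close> would close a 4-cycle. So out-neighbours of \<open>a\<close> lie in
      \<open>?A\<close>, where they are few, or in \<open>?Q\<close>.\<close>
    have "{w \<in> H. R a w} \<subseteq> {w \<in> ?A. R a w} \<union> ?Q"
    proof
      fix w assume w: "w \<in> {w \<in> H. R a w}"
      have "w \<noteq> u" using w a uv no3[of u v a] by auto
      moreover have "\<not> R w u"
        using no4[of u v a w] w a uv irrefl by auto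
      ultimately show "w \<in> {w \<in> ?A. R a w} \<union> ?Q" using w by auto
    qed
    then have "outdeg R a H \<le> card ({w \<in> ?A. R a w} \<union> ?Q)"
      unfolding outdeg_def using finite_H by (intro card_mono) auto
    also have "\<dots> \<le> outdeg R a ?A + card ?Q"
      unfolding outdeg_def by (rule card_Un_le)
    also have "card ?Q = card H - (card ?A + card ?B + 1)"
      using sub fin AB by (subst card_Diff_subset) (auto simp: card_Un_disjoint)
    finally show ?thesis using a cardH dA dB by (intro exI[of _ a]) auto
  qed
qed

text \<open>The previous bound, applied to the arc and to its reversal, yields \<open>a\<close> at
  or after \<open>v\<close> with low out-degree and \<open>b\<close> at or before \<open>u\<close>
  with low in-degree. An arc from \<open>a\<close> to \<open>b\<close> would be the missing reverse
  arc or close a short cycle, so \<open>ore\<close> bounds their degree sum from below.\<close>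

lemma (in short_free) one_way_arc_bound:
  assumes uv: "u \<in> H" "v \<in> H" "R u v" "\<not> R v u"
  shows "2 * L + 3 * (outdeg R v H + indeg R u H) + 4 \<le> 4 * card H"
proof -
  interpret conv: short_free "R\<inverse>\<inverse>" H L
    using short_free_converse[of R H L] short_free_axioms by blast
  obtain a where a: "a = v \<or> a \<in> H \<and> R v a"
    "2 * outdeg R a H + outdeg R v H + 2 * indeg R u H + 2 \<le> 2 * card H"
    using low_outdeg_beyond_arc[OF uv] by blast
  obtain b where b: "b = u \<or> b \<in> H \<and> R b u"
    "2 * indeg R b H + indeg R u H + 2 * outdeg R v H + 2 \<le> 2 * card H"
    using conv.low_outdeg_beyond_arc[of v u] uv by auto
  have "\<not> R a b" "a \<noteq> b"
    using a(1) b(1) uv no3[of u v a] no3[of u v b] no4[of u v a b] irrefl by auto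
  then have "L \<le> outdeg R a H + indeg R b H" using ore a(1) b(1) uv by blast
  then have "2 * L \<le> 2 * outdeg R a H + 2 * indeg R b H" by simp
  moreover have "2 * (outdeg R a H + indeg R b H) + 3 * (outdeg R v H + indeg R u H) + 4 \<le> 4 * card H"
    using add_mono[OF a(2) b(2)] by (simp add: algebra_simps)
  ultimately show ?thesis by simp
qed

text \<open>A minimal element \<open>p\<close> is paired with one other element \<open>q\<close>;
  every further \<open>x\<close> satisfies \<open>T <= d p + d x <= 2 * d x\<close>.\<close>

lemma sum_ge_if_pairs_ge:
  fixes d :: "'a \<Rightarrow> nat"
  assumes fin: "finite N" and card: "2 \<le> card N"
    and pair: "\<And>p q. \<lbrakk>p \<in> N; q \<in> N; p \<noteq> q\<rbrakk> \<Longrightarrow> T \<le> d p + d q"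
  shows "card N * T \<le> 2 * (\<Sum>p\<in>N. d p)"
proof -
  have "Min (d ` N) \<in> d ` N" using fin card by (intro Min_in) auto
  then obtain p where p: "p \<in> N" "Min (d ` N) = d p" by auto
  then have min: "d p \<le> d q" if "q \<in> N" for q
    using that fin by (metis Min_le finite_imageI imageI)
  have "card (N - {p}) \<noteq> 0" using card p fin by simp
  then obtain q where q: "q \<in> N - {p}" by (metis card.empty ex_in_conv)
  have "(\<Sum>x\<in>N - {p} - {q}. T) \<le> (\<Sum>x\<in>N - {p} - {q}. 2 * d x)"
  proof (rule sum_mono)
    fix x assume x: "x \<in> N - {p} - {q}"
    then show "T \<le> 2 * d x" using pair[of p x] min[of x] p(1) by auto
  qed
  then have rest: "card (N - {p} - {q}) * T \<le> 2 * (\<Sum>x\<in>N - {p} - {q}. d x)"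
    by (simp add: sum_distrib_left)
  have "card N = 2 + card (N - {p} - {q})" using p(1) q fin card by simp
  then have "card N * T = 2 * T + card (N - {p} - {q}) * T" by (simp only: add_mult_distrib)
  moreover have "(\<Sum>x\<in>N. d x) = d p + (d q + (\<Sum>x\<in>N - {p} - {q}. d x))"
    using sum.remove[OF fin p(1), of d] sum.remove[of "N - {p}" q d] fin q by simp
  moreover have "T \<le> d p + d q" using pair[of p q] p(1) q by auto
  ultimately show ?thesis using rest by linarith
qed

text \<open>Away from \<open>W\<close> the digraph is a graph of girth at least 5, in which the degrees of the
  neighbours of a vertex add up to less than the order.\<close>

lemma (in short_free) symmetric_degree_bound:
  assumes W: "W \<subseteq> H"
    and sym: "\<And>a b. \<lbrakk>a \<in> H - W; b \<in> H - W; R a b\<rbrakk> \<Longrightarrow> R b a"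
    and i: "i \<in> H - W" "2 \<le> outdeg R i (H - W)"
    and T: "T + 2 * card W = L"
  shows "outdeg R i (H - W) * T + 2 * card W + 2 \<le> 2 * card H"
proof -
  let ?F = "H - W"
  let ?d = "\<lambda>p. outdeg R p ?F"
  let ?N = "{p \<in> ?F. R i p}"
  have finW: "finite W" "finite ?F" using W finite_H finite_subset by auto
  have finN: "finite ?N" using finW by auto
  \<comment> \<open>Each of the two degrees loses at most \<open>card W\<close> when
    \<open>W\<close> is deleted; this is why \<open>T\<close> is \<open>L\<close> minus
    \<open>2 * card W\<close>.\<close>
  have pair: "T \<le> ?d p + ?d q" if "p \<in> ?F" "q \<in> ?F" "p \<noteq> q" "\<not> R p q" for p q
  proof -
    have "H = ?F \<union> W" using W by auto
    then have split: "outdeg Q x H = outdeg Q x ?F + outdeg Q x W" for Q x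
      using outdeg_Un_disjoint[of ?F W Q x] finW by auto
    have "indeg R q ?F = ?d q"
      unfolding outdeg_def using sym that by (intro arg_cong[where f = card]) auto
    then show ?thesis
      using ore[of p q] that T split[of R p] split[of "R\<inverse>\<inverse>" q]
        outdeg_le_card[OF finW(1), of R p] outdeg_le_card[OF finW(1), of "R\<inverse>\<inverse>" q] by auto
  qed
  have indep: "\<not> R p q" if "p \<in> ?N" "q \<in> ?N" for p q
  proof
    assume "R p q"
    moreover have "R q i" using sym[of i q] that i by simp
    ultimately show False using no3[of i p q] that i by simp
  qed
  \<comment> \<open>The vertex \<open>i\<close>, its neighbours and their further neighbours are all
    distinct: a coincidence would give a triangle or a 4-cycle. In \<open>?d p\<close> the neighbour
    \<open>i\<close> is counted too, which makes up for \<open>p\<close> itself.\<close>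
  have upper: "(\<Sum>p\<in>?N. ?d p) + 1 \<le> card ?F"
  proof -
    let ?P = "\<lambda>p. {w \<in> ?F. R p w} - {i}"
    have "card (\<Union>p\<in>?N. ?P p) = (\<Sum>p\<in>?N. card (?P p))"
    proof (intro card_UN_disjoint ballI impI)
      fix p q assume pq: "p \<in> ?N" "q \<in> ?N" "p \<noteq> q"
      have "False" if "w \<in> ?P p \<inter> ?P q" for w
        using no4[of i p w q] sym[of q w] sym[of i q] that pq i by auto
      then show "?P p \<inter> ?P q = {}" by blast
    qed (use finW in auto)
    moreover have *: "card (?P p) + 1 = ?d p" if "p \<in> ?N" for p
    proof -
      have "i \<in> {w \<in> ?F. R p w}" using that sym[of i p] i by simp
      moreover have "finite {w \<in> ?F. R p w}" using finW by auto
      ultimately show ?thesis unfolding outdeg_def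
        using card_Suc_Diff1[of "{w \<in> ?F. R p w}" i] by simp
    qed
    ultimately have "card (\<Union>p\<in>?N. ?P p) + card ?N = (\<Sum>p\<in>?N. card (?P p) + 1)"
      by (simp only: sum.distrib card_eq_sum)
    also have "\<dots> = (\<Sum>p\<in>?N. ?d p)" using * by (rule sum.cong[OF refl])
    finally have "card (\<Union>p\<in>?N. ?P p) + card ?N = (\<Sum>p\<in>?N. ?d p)" .
    moreover have "card (\<Union>p\<in>?N. ?P p) + card ?N + 1 = card (insert i ((\<Union>p\<in>?N. ?P p) \<union> ?N))"
    proof -
      have "False" if "w \<in> ?P p" "p \<in> ?N" "w \<in> ?N" for w p
        using indep[OF that(2,3)] that(1) by simp
      then have "(\<Union>p\<in>?N. ?P p) \<inter> ?N = {}" by fast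
      moreover have "i \<notin> (\<Union>p\<in>?N. ?P p) \<union> ?N" using irrefl by simp
      moreover have "finite (\<Union>p\<in>?N. ?P p)" using finW finN by simp
      ultimately show ?thesis using finN by (subst card_insert_disjoint; simp only: card_Un_disjoint finite_Un)
    qed
    moreover have "\<dots> \<le> card ?F" using finW i by (intro card_mono) auto
    ultimately show ?thesis by simp
  qed
  have lower: "card ?N * T \<le> 2 * (\<Sum>p\<in>?N. ?d p)"
  proof (rule sum_ge_if_pairs_ge[OF finN])
    show "2 \<le> card ?N" using i(2) by (simp only: outdeg_def)
    show "T \<le> ?d p + ?d q" if "p \<in> ?N" "q \<in> ?N" "p \<noteq> q" for p q
      using pair[of p q] indep[OF that(1,2)] that by simp
  qed
  have "card ?F + card W = card H"
    using card_Diff_subset[OF finW(1) W] card_mono[OF finite_H W] by simp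
  then show ?thesis using upper lower by (simp add: outdeg_def)
qed

text \<open>Among three vertices outside \<open>W\<close> some arc is missing, since otherwise they
  form a triangle. One end of the missing arc has at least half of what \<open>ore\<close>
  guarantees after the loss to \<open>W\<close>.\<close>

lemma (in short_free) exists_high_degree:
  assumes W: "W \<subseteq> H" "card W + 3 \<le> card H"
    and sym: "\<And>a b. \<lbrakk>a \<in> H - W; b \<in> H - W; R a b\<rbrakk> \<Longrightarrow> R b a"
  shows "\<exists>i\<in>H - W. L \<le> 2 * outdeg R i (H - W) + 2 * card W"
proof -
  let ?F = "H - W"
  have finW: "finite W" "finite ?F" using W finite_H finite_subset by auto
  have "3 \<le> card ?F" using card_Diff_subset[OF finW(1) W(1)] W(2) by simp
  then obtain S where "S \<subseteq> ?F" "card S = 3" by (meson obtain_subset_with_card_n)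
  then obtain x y z where xyz: "{x, y, z} \<subseteq> ?F" "x \<noteq> y" "y \<noteq> z" "x \<noteq> z"
    by (auto simp: card_3_iff)
  then have "\<exists>p q. p \<in> ?F \<and> q \<in> ?F \<and> p \<noteq> q \<and> \<not> R p q"
    using no3[of x y z] by (metis DiffD1 insert_subset)
  then obtain p q where pq: "p \<in> ?F" "q \<in> ?F" "p \<noteq> q" "\<not> R p q" by blast
  have "H = ?F \<union> W" using W by auto
  then have split: "outdeg Q x H = outdeg Q x ?F + outdeg Q x W" for Q x
    using outdeg_Un_disjoint[of ?F W Q x] finW by auto
  have "indeg R q ?F = outdeg R q ?F"
    unfolding outdeg_def using sym pq by (intro arg_cong[where f = card]) auto
  then have "L \<le> outdeg R p ?F + outdeg R q ?F + 2 * card W"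
    using ore[of p q] pq split[of R p] split[of "R\<inverse>\<inverse>" q]
      outdeg_le_card[OF finW(1), of R p] outdeg_le_card[OF finW(1), of "R\<inverse>\<inverse>" q] by auto
  then show ?thesis using pq by (cases "outdeg R p ?F \<le> outdeg R q ?F") force+
qed


section \<open>Packings of maximum weight and exchange arguments\<close>

lemma packing_insert:
  assumes "packing R V F" "C \<subseteq> V - \<Union>F" "dicycle3 R C \<or> dicycle4 R C"
  shows "packing R V (insert C F)"
  using assms unfolding packing_def by (auto simp: pairwise_insert disjnt_def)

lemma packing_remove: "packing R V F \<Longrightarrow> packing R V (F - G)"
  unfolding packing_def by (auto simp: pairwise_def)

text \<open>Two nonempty sets of this kind are the same singleton. It is used for the vertices of
  one packed triangle that close two disjoint arcs to triangles.\<close>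

lemma disjoint_representatives:
  assumes "finite A" "finite B" "\<And>a b. a \<in> A \<Longrightarrow> b \<in> B \<Longrightarrow> a = b"
  shows "card A = 0 \<or> card B = 0 \<or> (card A = 1 \<and> card B = 1)"
proof (cases "A = {} \<or> B = {}")
  case False
  then obtain a b where "a \<in> A" "b \<in> B" by blast
  then have "A = {b}" "B = {b}" using assms(3) by blast+
  then show ?thesis by simp
qed auto

text \<open>The weight rewards every cycle, triangles more than 4-cycles, so that it grows when a
  4-cycle is exchanged for a triangle or one cycle for two.\<close>

locale max_packing =
  fixes R :: "'a \<Rightarrow> 'a \<Rightarrow> bool" and V :: "'a set" and F :: "'a set set"
  assumes finite_V: "finite V"
    and irrefl: "\<not> R a a"
    and packing: "packing R V F"
    and maximal: "packing R V G \<Longrightarrow> weight G \<le> weight F"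
    and ore: "\<lbrakk>a \<in> V; b \<in> V; a \<noteq> b; \<not> R a b\<rbrakk> \<Longrightarrow> card V \<le> outdeg R a V + indeg R b V"
    and large: "12 * card F + 3 \<le> card V"
begin

definition triangles :: "'a set set" where "triangles = {C \<in> F. card C = 3}"
definition quads :: "'a set set" where "quads = {C \<in> F. card C = 4}"

abbreviation r3 :: nat where "r3 \<equiv> card triangles"
abbreviation r4 :: nat where "r4 \<equiv> card quads"

definition H :: "'a set" where "H = V - \<Union>F"

lemma finite_F: "finite F"
  using packing finite_V unfolding packing_def by (meson finite_Pow_iff finite_subset)

lemma F_subset: "C \<in> F \<Longrightarrow> C \<subseteq> V"
  using packing unfolding packing_def by auto

lemma finite_mem: "C \<in> F \<Longrightarrow> finite C"
  using F_subset finite_V finite_subset by blast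

lemma F_disjoint: "\<lbrakk>C \<in> F; D \<in> F; C \<noteq> D\<rbrakk> \<Longrightarrow> C \<inter> D = {}"
  using packing unfolding packing_def pairwise_def disjnt_def by auto

lemma F_split: "F = triangles \<union> quads" "triangles \<inter> quads = {}" "finite triangles" "finite quads"
proof -
  have "card C = 3 \<or> card C = 4" if "C \<in> F" for C
    using packing that card_dicycle3 card_dicycle4 unfolding packing_def by blast
  then show "F = triangles \<union> quads" by (auto simp: triangles_def quads_def)
qed (use finite_F in \<open>auto simp: triangles_def quads_def\<close>)

lemma sum_F: "(\<Sum>C\<in>F. g C) = (\<Sum>C\<in>triangles. g C) + (\<Sum>C\<in>quads. g C)" for g :: "'a set \<Rightarrow> nat"
  by (subst F_split(1)) (rule sum.union_disjoint[OF F_split(3,4,2)])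

lemma card_F: "card F = r3 + r4"
  by (subst F_split(1)) (rule card_Un_disjoint[OF F_split(3,4,2)])

lemma card_Union_F: "card (\<Union>F) = 3 * r3 + 4 * r4"
proof -
  have "card (\<Union>F) = (\<Sum>C\<in>F. card C)"
    using packing finite_mem by (intro card_Union_disjoint) (auto simp: packing_def)
  also have "\<dots> = 3 * r3 + 4 * r4"
    unfolding sum_F by (simp add: triangles_def quads_def)
  finally show ?thesis .
qed

lemma Union_F_subset: "\<Union>F \<subseteq> V" using F_subset by auto

lemma card_H: "card V = card H + (3 * r3 + 4 * r4)"
proof -
  have "card H = card V - card (\<Union>F)"
    unfolding H_def using Union_F_subset finite_V by (meson card_Diff_subset finite_subset)
  moreover have "card (\<Union>F) \<le> card V" using Union_F_subset finite_V by (rule card_mono[rotated])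
  ultimately show ?thesis using card_Union_F by simp
qed

lemma H_large: "9 * r3 + 8 * r4 + 3 \<le> card H"
  using large card_F card_H by simp

lemma outdeg_V: "outdeg Q u V = outdeg Q u H + (\<Sum>C\<in>F. outdeg Q u C)"
proof -
  have "V = H \<union> \<Union>F" using Union_F_subset by (auto simp: H_def)
  moreover have "outdeg Q u (H \<union> \<Union>F) = outdeg Q u H + outdeg Q u (\<Union>F)"
    using finite_V Union_F_subset finite_subset
    by (intro outdeg_Un_disjoint) (auto simp: H_def)
  moreover have "outdeg Q u (\<Union>F) = (\<Sum>C\<in>F. outdeg Q u C)"
    using packing finite_F finite_mem by (intro outdeg_Union) (auto simp: packing_def)
  ultimately show ?thesis by simp
qed

lemma weight_insert:
  assumes "finite G" "C \<inter> \<Union>G = {}" "C \<noteq> {}"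
  shows "weight (insert C G) = 5 - card C + weight G"
proof -
  have "C \<notin> G" using assms by auto
  then show ?thesis using assms(1) by (simp add: weight_def)
qed

lemma weight_remove: "C \<in> F \<Longrightarrow> weight F = 5 - card C + weight (F - {C})"
  unfolding weight_def using finite_F by (rule sum.remove)

lemma no_short_dicycle_in_H:
  assumes "C \<subseteq> H" shows "\<not> dicycle3 R C" "\<not> dicycle4 R C"
proof -
  have False if "dicycle3 R C \<or> dicycle4 R C"
  proof -
    have "card C \<in> {3, 4}" using that card_dicycle3 card_dicycle4 by blast
    moreover from this have "C \<noteq> {}" by auto
    moreover have "C \<inter> \<Union>F = {}" using assms by (auto simp: H_def)
    ultimately have "weight (insert C F) > weight F"
      using weight_insert[OF finite_F] by auto
    moreover have "packing R V (insert C F)"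
      using packing_insert[OF packing _ that] assms by (simp add: H_def)
    ultimately show False using maximal by fastforce
  qed
  then show "\<not> dicycle3 R C" "\<not> dicycle4 R C" by blast+
qed

text \<open>Cycles built from \<open>C\<close> and uncovered vertices may replace \<open>C\<close>
  without meeting the rest of the packing.\<close>

lemma avoids_rest: "\<lbrakk>C \<in> F; T \<subseteq> C \<union> H\<rbrakk> \<Longrightarrow> T \<subseteq> V - \<Union>(F - {C})"
proof
  fix x assume C: "C \<in> F" and "T \<subseteq> C \<union> H" "x \<in> T"
  then consider "x \<in> C" | "x \<in> H" by blast
  then show "x \<in> V - \<Union>(F - {C})"
  proof cases
    case 1
    have "x \<notin> D" if "D \<in> F - {C}" for D using F_disjoint[of C D] C 1 that by auto
    then show ?thesis using F_subset[OF C] 1 by auto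
  qed (auto simp: H_def)
qed

lemma no_triangle_via_quad:
  assumes C: "C \<in> quads" and T: "T \<subseteq> C \<union> H" "dicycle3 R T"
  shows False
proof -
  have CF: "C \<in> F" "card C = 4" using C by (auto simp: quads_def)
  have sub: "T \<subseteq> V - \<Union>(F - {C})" by (rule avoids_rest[OF CF(1) T(1)])
  have pack: "packing R V (insert T (F - {C}))"
    using packing_insert[OF packing_remove[OF packing] sub] T by blast
  moreover have "weight (insert T (F - {C})) = 2 + weight (F - {C})"
    using card_dicycle3[OF T(2)] sub finite_F by (subst weight_insert) auto
  ultimately show False using maximal[OF pack] weight_remove[OF CF(1)] CF(2) by simp
qed

text \<open>Replacing \<open>C\<close> by \<open>T\<close> and \<open>T'\<close> would raise the
  weight by 2.\<close>

lemma no_two_triangles_via_triangle: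
  assumes C: "C \<in> triangles"
    and T: "T \<subseteq> C \<union> H" "dicycle3 R T" and T': "T' \<subseteq> C \<union> H" "dicycle3 R T'"
    and disj: "T \<inter> T' = {}"
  shows False
proof -
  have CF: "C \<in> F" "card C = 3" using C by (auto simp: triangles_def)
  have sub: "T \<subseteq> V - \<Union>(F - {C})" "T' \<subseteq> V - \<Union>(F - {C})"
    using avoids_rest[OF CF(1)] T T' by auto
  have "packing R V (insert T (F - {C}))"
    using packing_insert[OF packing_remove[OF packing] sub(1)] T by blast
  then have pack: "packing R V (insert T' (insert T (F - {C})))"
    by (rule packing_insert) (use sub disj T' in auto)
  moreover have "weight (insert T (F - {C})) = 2 + weight (F - {C})"
    using card_dicycle3[OF T(2)] sub finite_F by (subst weight_insert) auto
  moreover have "weight (insert T' (insert T (F - {C}))) = 2 + weight (insert T (F - {C}))"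
    using card_dicycle3[OF T'(2)] sub finite_F disj by (subst weight_insert) auto
  ultimately show False using maximal[OF pack] weight_remove[OF CF(1)] CF(2) by simp
qed

text \<open>Each of the two degrees loses at most \<open>card (\<Union>F) = 3 * r3 + 4 * r4\<close>
  on passing from \<open>V\<close> to \<open>H\<close>, while \<open>card V\<close> exceeds
  \<open>card H\<close> by this number once. By \<open>H_large\<close> the subtraction does not
  truncate.\<close>

sublocale free: short_free R H "card H - (3 * r3 + 4 * r4)"
proof
  show "finite H" using finite_V by (simp add: H_def)
  show "\<not> R a a" for a by (rule irrefl)
  show False if "a \<in> H" "b \<in> H" "c \<in> H" "R a b" "R b c" "R c a" for a b c
  proof -
    have "distinct [a, b, c]" using that irrefl by auto
    then have "dicycle3 R {a, b, c}" using that unfolding dicycle3_def by blast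
    then show False using no_short_dicycle_in_H(1)[of "{a, b, c}"] that by simp
  qed
  show False if "a \<in> H" "b \<in> H" "c \<in> H" "d \<in> H" "a \<noteq> c" "b \<noteq> d"
    "R a b" "R b c" "R c d" "R d a" for a b c d
  proof -
    have "distinct [a, b, c, d]" using that irrefl by auto
    then have "dicycle4 R {a, b, c, d}" using that unfolding dicycle4_def by blast
    then show False using no_short_dicycle_in_H(2)[of "{a, b, c, d}"] that by simp
  qed
  show "card H - (3 * r3 + 4 * r4) \<le> outdeg R a H + indeg R b H"
    if ab: "a \<in> H" "b \<in> H" "a \<noteq> b" "\<not> R a b" for a b
  proof -
    have "(\<Sum>C\<in>F. outdeg Q x C) \<le> 3 * r3 + 4 * r4" for Q and x :: 'a
    proof -
      have "(\<Sum>C\<in>F. outdeg Q x C) \<le> (\<Sum>C\<in>F. card C)"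
        by (intro sum_mono outdeg_le_card finite_mem)
      also have "\<dots> = 3 * r3 + 4 * r4"
        unfolding sum_F by (simp add: triangles_def quads_def)
      finally show ?thesis .
    qed
    from this[of R a] this[of "R\<inverse>\<inverse>" b] show ?thesis
      using ore[of a b] ab card_H outdeg_V[of R a] outdeg_V[of "R\<inverse>\<inverse>" b] by (auto simp: H_def)
  qed
qed

section \<open>One-way arcs of uncovered vertices against the packing\<close>

definition oneway :: "'a \<Rightarrow> 'a \<Rightarrow> bool" where
  "oneway u v \<longleftrightarrow> u \<in> H \<and> v \<in> H \<and> R u v \<and> \<not> R v u"

definition closing :: "'a \<Rightarrow> 'a \<Rightarrow> 'a set \<Rightarrow> 'a set" where
  "closing u v C = {c \<in> C. R v c \<and> R c u}"

definition arc_deg :: "'a \<Rightarrow> 'a \<Rightarrow> 'a set \<Rightarrow> nat" where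
  "arc_deg u v C = outdeg R v C + indeg R u C"

text \<open>The missing arc from \<open>v\<close> to \<open>u\<close> forces a large degree sum in
  \<open>V\<close>, and \<open>one_way_arc_bound\<close> limits the share of \<open>H\<close>. Three
  times the remaining sum is at least \<open>12 * r3 + 12 * r4 + 7\<close>; dividing and rounding up
  gives the constant 3.\<close>

lemma sum_arc_deg:
  assumes "oneway u v"
  shows "4 * r3 + 4 * r4 + 3 \<le> (\<Sum>C\<in>F. arc_deg u v C)"
proof -
  have uv: "u \<in> H" "v \<in> H" "R u v" "\<not> R v u" using assms by (auto simp: oneway_def)
  have "card V \<le> outdeg R v V + indeg R u V"
    using ore[of v u] uv irrefl by (auto simp: H_def)
  then have "card V \<le> (outdeg R v H + indeg R u H) + (\<Sum>C\<in>F. arc_deg u v C)"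
    unfolding outdeg_V arc_deg_def sum.distrib by simp
  then show ?thesis
    using free.one_way_arc_bound[OF uv] H_large card_H by simp
qed

lemma closing_triangle:
  assumes "oneway u v" "C \<in> F" "c \<in> closing u v C"
  shows "dicycle3 R {u, v, c}" "{u, v, c} \<subseteq> C \<union> H" "c \<notin> H"
proof -
  have *: "u \<in> H" "v \<in> H" "R u v" "R v c" "R c u" "c \<in> C"
    using assms by (auto simp: oneway_def closing_def)
  then have "distinct [u, v, c]" using irrefl by auto
  then show "dicycle3 R {u, v, c}" using * unfolding dicycle3_def by blast
  show "{u, v, c} \<subseteq> C \<union> H" "c \<notin> H" using * assms(2) by (auto simp: H_def)
qed

text \<open>By inclusion-exclusion, the vertices of \<open>C\<close> counted twice are exactly the
  closing ones.\<close>

lemma arc_deg_le: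
  assumes "C \<in> F" shows "arc_deg u v C \<le> card C + card (closing u v C)"
proof -
  have fin: "finite C" using assms finite_mem by blast
  have "arc_deg u v C = card ({w \<in> C. R v w} \<union> {w \<in> C. R w u}) + card ({w \<in> C. R v w} \<inter> {w \<in> C. R w u})"
    unfolding arc_deg_def outdeg_def using card_Un_Int[of "{w \<in> C. R v w}" "{w \<in> C. R w u}"] fin by simp
  also have "{w \<in> C. R v w} \<inter> {w \<in> C. R w u} = closing u v C" by (auto simp: closing_def)
  also have "card ({w \<in> C. R v w} \<union> {w \<in> C. R w u}) \<le> card C" using fin by (intro card_mono) auto
  finally show ?thesis by simp
qed

lemma arc_deg_quad:
  assumes "oneway u v" "C \<in> quads" shows "arc_deg u v C \<le> 4"
proof -
  have CF: "C \<in> F" "card C = 4" using assms by (auto simp: quads_def)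
  have "closing u v C = {}"
    using no_triangle_via_quad[OF assms(2)] closing_triangle[OF assms(1) CF(1)] by blast
  then show ?thesis using arc_deg_le[OF CF(1), of u v] CF(2) by simp
qed

lemma arc_deg_triangle:
  assumes "C \<in> triangles"
  shows "arc_deg u v C \<le> 3 + card (closing u v C)" "card (closing u v C) \<le> 3" "finite (closing u v C)"
proof -
  have CF: "C \<in> F" "card C = 3" using assms by (auto simp: triangles_def)
  show fin: "finite (closing u v C)" using finite_mem[OF CF(1)] by (simp add: closing_def)
  show "arc_deg u v C \<le> 3 + card (closing u v C)" using arc_deg_le[OF CF(1), of u v] CF by simp
  have "closing u v C \<subseteq> C" by (auto simp: closing_def)
  then show "card (closing u v C) \<le> 3" using CF finite_mem by (metis card_mono)
qed

text \<open>Different closing vertices for the two arcs would give two disjoint triangles in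
  exchange for \<open>C\<close>.\<close>

lemma closing_disjoint_arcs:
  assumes "C \<in> triangles" "oneway u v" "oneway u' v'" "{u, v} \<inter> {u', v'} = {}"
  shows "card (closing u v C) = 0 \<or> card (closing u' v' C) = 0
    \<or> (card (closing u v C) = 1 \<and> card (closing u' v' C) = 1)"
proof (intro disjoint_representatives)
  fix a b assume ab: "a \<in> closing u v C" "b \<in> closing u' v' C"
  have CF: "C \<in> F" using assms by (auto simp: triangles_def)
  have "u \<in> H" "v \<in> H" "u' \<in> H" "v' \<in> H" using assms by (auto simp: oneway_def)
  then have "{u, v, a} \<inter> {u', v', b} = {}" if "a \<noteq> b"
    using that assms(4) closing_triangle(3)[OF assms(2) CF ab(1)] closing_triangle(3)[OF assms(3) CF ab(2)]
    by auto
  then show "a = b"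
    using no_two_triangles_via_triangle[OF assms(1)]
      closing_triangle[OF assms(2) CF ab(1)] closing_triangle[OF assms(3) CF ab(2)] by blast
qed (use arc_deg_triangle assms in auto)

lemma sum_F_bound:
  fixes g :: "'a set \<Rightarrow> nat"
  assumes "\<And>C. C \<in> triangles \<Longrightarrow> g C \<le> p" "\<And>C. C \<in> quads \<Longrightarrow> g C \<le> q"
  shows "(\<Sum>C\<in>F. g C) \<le> p * r3 + q * r4"
proof -
  have "(\<Sum>C\<in>triangles. g C) \<le> r3 * p" "(\<Sum>C\<in>quads. g C) \<le> r4 * q"
    using sum_bounded_above[of triangles g p] sum_bounded_above[of quads g q] assms by auto
  then show ?thesis unfolding sum_F by (metis add_mono mult.commute)
qed

text \<open>A packed triangle contributes at most 6 and a packed 4-cycle at most 4 to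
  \<open>sum_arc_deg\<close>, so triangles must supply the surplus of 3.\<close>

lemma one_oneway:
  assumes "oneway u v" shows "2 \<le> r3"
proof -
  have "(\<Sum>C\<in>F. arc_deg u v C) \<le> 6 * r3 + 4 * r4"
    using arc_deg_triangle[of _ u v] arc_deg_quad[OF assms]
    by (intro sum_F_bound) force+
  then show ?thesis using sum_arc_deg[OF assms] by linarith
qed

text \<open>On a packed triangle two disjoint arcs have at most 3 closing vertices counted together,
  hence the 9. The bound 4 is the number of ends of the two arcs, which will form
  \<open>W\<close>.\<close>

lemma two_oneway:
  assumes "oneway u v" "oneway u' v'" "{u, v} \<inter> {u', v'} = {}" shows "4 \<le> r3"
proof -
  have "(\<Sum>C\<in>F. arc_deg u v C + arc_deg u' v' C) \<le> 9 * r3 + 8 * r4"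
  proof (rule sum_F_bound)
    show "arc_deg u v C + arc_deg u' v' C \<le> 9" if "C \<in> triangles" for C
      using arc_deg_triangle[OF that, of u v] arc_deg_triangle[OF that, of u' v']
        closing_disjoint_arcs[OF that assms] by auto
    show "arc_deg u v C + arc_deg u' v' C \<le> 8" if "C \<in> quads" for C
      using arc_deg_quad[OF assms(1) that] arc_deg_quad[OF assms(2) that] by simp
  qed
  then show ?thesis
    using sum_arc_deg[OF assms(1)] sum_arc_deg[OF assms(2)] by (simp add: sum.distrib)
qed

text \<open>Even three disjoint arcs have at most 3 closing vertices counted together on a packed
  triangle, so every packed cycle contributes at most 12, too little for three times
  \<open>sum_arc_deg\<close>.\<close>

lemma three_oneway:
  assumes "oneway u v" "oneway u' v'" "oneway u'' v''"
    and "{u, v} \<inter> {u', v'} = {}" "{u, v} \<inter> {u'', v''} = {}" "{u', v'} \<inter> {u'', v''} = {}"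
  shows False
proof -
  have "(\<Sum>C\<in>F. arc_deg u v C + arc_deg u' v' C + arc_deg u'' v'' C) \<le> 12 * r3 + 12 * r4"
  proof (rule sum_F_bound)
    show "arc_deg u v C + arc_deg u' v' C + arc_deg u'' v'' C \<le> 12" if "C \<in> triangles" for C
      using arc_deg_triangle[OF that, of u v] arc_deg_triangle[OF that, of u' v']
        arc_deg_triangle[OF that, of u'' v'']
        closing_disjoint_arcs[OF that assms(1,2,4)] closing_disjoint_arcs[OF that assms(1,3,5)]
        closing_disjoint_arcs[OF that assms(2,3,6)] by auto
    show "arc_deg u v C + arc_deg u' v' C + arc_deg u'' v'' C \<le> 12" if "C \<in> quads" for C
      using arc_deg_quad[OF assms(1) that] arc_deg_quad[OF assms(2) that] arc_deg_quad[OF assms(3) that]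
      by simp
  qed
  then show False
    using sum_arc_deg[OF assms(1)] sum_arc_deg[OF assms(2)] sum_arc_deg[OF assms(3)]
    by (simp add: sum.distrib)
qed

text \<open>\<open>W\<close> consists of the ends of a maximal matching of one-way arcs, which has at most two
  members.\<close>

lemma oneway_cover: "\<exists>W\<subseteq>H. card W \<le> r3 \<and> (\<forall>u v. oneway u v \<longrightarrow> u \<in> W \<or> v \<in> W)"
proof (cases "\<exists>u v. oneway u v")
  case False
  then show ?thesis by (intro exI[of _ "{}"]) auto
next
  case True
  then obtain u v where uv: "oneway u v" by blast
  show ?thesis
  proof (cases "\<exists>u' v'. oneway u' v' \<and> {u, v} \<inter> {u', v'} = {}")
    case False
    have "card {u, v} \<le> 2" by (simp add: card_insert_if)
    then show ?thesis using False uv one_oneway[OF uv]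
      by (intro exI[of _ "{u, v}"]) (auto simp: oneway_def)
  next
    case True
    then obtain u' v' where uv': "oneway u' v'" "{u, v} \<inter> {u', v'} = {}" by blast
    have "card {u, v, u', v'} \<le> 4" by (simp add: card_insert_if)
    moreover have "x \<in> {u, v, u', v'} \<or> y \<in> {u, v, u', v'}" if "oneway x y" for x y
      using three_oneway[OF uv uv'(1) that uv'(2)] by auto
    ultimately show ?thesis using uv uv' two_oneway[OF uv uv']
      by (intro exI[of _ "{u, v, u', v'}"]) (auto simp: oneway_def)
  qed
qed

lemma contradiction: False
proof -
  obtain W where W: "W \<subseteq> H" "card W \<le> r3" "\<And>u v. oneway u v \<Longrightarrow> u \<in> W \<or> v \<in> W"
    using oneway_cover by blast
  have sym: "R b a" if "a \<in> H - W" "b \<in> H - W" "R a b" for a b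
    using W(3)[of a b] that by (auto simp: oneway_def)
  have "card W + 3 \<le> card H" using W(2) H_large by linarith
  then obtain i where i: "i \<in> H - W" 
    "card H - (3 * r3 + 4 * r4) \<le> 2 * outdeg R i (H - W) + 2 * card W"
    using free.exists_high_degree[OF W(1) _ sym] by blast
  define T where "T = card H - (3 * r3 + 4 * r4) - 2 * card W"
  have T: "T + 2 * card W = card H - (3 * r3 + 4 * r4)" "3 \<le> T"
    unfolding T_def using W(2) H_large by linarith+
  \<comment> \<open>The choice of \<open>i\<close> says that \<open>T\<close> is at most twice its
    degree, and \<open>T\<close> is at least 3.\<close>
  have "2 \<le> outdeg R i (H - W)" using i(2) T by linarith
  from free.symmetric_degree_bound[OF W(1) sym i(1) this T(1)]
  have bound: "outdeg R i (H - W) * T + 2 * card W + 2 \<le> 2 * card H" .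
  show False
  \<comment> \<open>For an empty packing \<open>W\<close> is empty and \<open>T = card H\<close>, so
    degree 2 suffices. Otherwise \<open>T\<close> is at least 7, which raises the degree to 4; then
    \<open>bound\<close> would require \<open>2 * card H + 2 <= 18 * r3 + 16 * r4\<close>, against
    \<open>H_large\<close>.\<close>
  proof (cases "r3 + r4 = 0")
    case True
    then have "T = card H" "card W = 0" using T W(2) by auto
    moreover have "2 * T \<le> outdeg R i (H - W) * T"
      using \<open>2 \<le> outdeg R i (H - W)\<close> by (rule mult_right_mono) simp
    ultimately show False using bound by linarith
  next
    case False
    then have "4 \<le> outdeg R i (H - W)" using i(2) W(2) H_large by linarith
    then have "4 * T \<le> outdeg R i (H - W) * T" by (rule mult_right_mono) simp
    then show False using bound T(1) W(2) H_large by linarith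
  qed
qed

end

theorem disjoint_short_dicycles:
  assumes fin: "finite V" and irr: "\<And>a. \<not> R a a"
    and ore: "\<And>a b. \<lbrakk>a \<in> V; b \<in> V; a \<noteq> b; \<not> R a b\<rbrakk> \<Longrightarrow> card V \<le> outdeg R a V + indeg R b V"
    and large: "12 * k \<le> card V + 9"
  shows "\<exists>F. packing R V F \<and> card F = k"
proof -
  let ?S = "{G. packing R V G}"
  have finS: "finite ?S"
    by (rule finite_subset[of _ "Pow (Pow V)"]) (use fin in \<open>auto simp: packing_def\<close>)
  have "{} \<in> ?S" by (simp add: packing_def)
  then have "Max (weight ` ?S) \<in> weight ` ?S" using finS by (intro Max_in) auto
  then obtain F where F: "packing R V F" "weight F = Max (weight ` ?S)" by auto
  have max: "weight G \<le> weight F" if "packing R V G" for G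
    unfolding F(2) using that finS by (intro Max_ge) auto
  have "k \<le> card F"
  proof (rule ccontr)
    assume "\<not> k \<le> card F"
    \<comment> \<open>From \<open>card F + 1 <= k\<close>, the number
      \<open>12 * card F + 12\<close> is at most \<open>card V + 9\<close>.\<close>
    then have "12 * card F + 3 \<le> card V" using large by linarith
    then interpret max_packing R V F
      using fin irr F(1) max ore by unfold_locales
    show False by (rule contradiction)
  qed
  then obtain G where "G \<subseteq> F" "card G = k" by (meson obtain_subset_with_card_n)
  then have "packing R V G" using packing_remove[OF F(1), of "F - G"] by (simp add: double_diff)
  then show ?thesis using \<open>card G = k\<close> by blast
qed

section \<open>Alternating cycles of length 6 and 8 as explicit lists\<close>

lemma cycle_edges_conv: "cycle_edges C = (\<lambda>i. {C ! i, C ! ((i + 1) mod length C)}) ` {..<length C}"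
  unfolding cycle_edges_def by auto

lemma lessThan_6: "{..<6::nat} = {5, 4, 3, 2, 1, 0}"
  by auto

lemma lessThan_8: "{..<8::nat} = {7, 6, 5, 4, 3, 2, 1, 0}"
  by auto

lemma length_list6: "length [a, b, c, d, e, f] = 6"
  by simp

lemma length_list8: "length [a, b, c, d, e, f, g, h] = 8"
  by simp

text \<open>Primes mark matching partners. Each arc of the contracted triangle, such as the one from
  \<open>a\<close> to \<open>b\<close>, expands to the edge from \<open>a\<close> to
  \<open>b'\<close> followed by the matching edge from \<open>b'\<close> to
  \<open>b\<close>.\<close>

lemma is_M_cycle_6:
  assumes "distinct [a, b', b, c', c, a']"
    and "{{a, b'}, {b, c'}, {c, a'}} \<subseteq> E - M" "{{a, a'}, {b, b'}, {c, c'}} \<subseteq> E \<inter> M"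
  shows "is_M_cycle E M [a, b', b, c', c, a']"
proof -
  have "cycle_edges [a, b', b, c', c, a'] =
      {{a', a}, {c, a'}, {c', c}, {b, c'}, {b', b}, {a, b'}}"
    unfolding cycle_edges_conv length_list6 by (simp only: lessThan_6 image_insert image_empty) simp
  also have "\<dots> = {{a, b'}, {b, c'}, {c, a'}} \<union> {{a, a'}, {b, b'}, {c, c'}}"
    unfolding insert_commute[of a' a] insert_commute[of c' c] insert_commute[of b' b]
    by (simp only: Un_insert_left Un_empty_left insert_commute)
  finally have eq: "cycle_edges [a, b', b, c', c, a'] =
      {{a, b'}, {b, c'}, {c, a'}} \<union> {{a, a'}, {b, b'}, {c, c'}}" .
  then have "cycle_edges [a, b', b, c', c, a'] \<inter> M = {{a, a'}, {b, b'}, {c, c'}}"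
    using assms(2,3)
    by (simp only: Un_insert_left Un_empty_left insert_subset Diff_iff Int_iff Int_insert_left
        Int_empty_left simp_thms if_True if_False)
  moreover have "card {{a, a'}, {b, b'}, {c, c'}} = 3"
    using assms(1) by (simp add: doubleton_eq_iff)
  moreover have "cycle_edges [a, b', b, c', c, a'] \<subseteq> E" unfolding eq using assms(2,3) by simp
  ultimately show ?thesis
    using assms(1) unfolding is_M_cycle_def is_cycle_def by simp
qed

lemma is_M_cycle_8:
  assumes "distinct [a, b', b, c', c, d', d, a']"
    and "{{a, b'}, {b, c'}, {c, d'}, {d, a'}} \<subseteq> E - M"
    and "{{a, a'}, {b, b'}, {c, c'}, {d, d'}} \<subseteq> E \<inter> M"
  shows "is_M_cycle E M [a, b', b, c', c, d', d, a']"
proof -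
  have "cycle_edges [a, b', b, c', c, d', d, a'] =
      {{a', a}, {d, a'}, {d', d}, {c, d'}, {c', c}, {b, c'}, {b', b}, {a, b'}}"
    unfolding cycle_edges_conv length_list8 by (simp only: lessThan_8 image_insert image_empty) simp
  also have "\<dots> = {{a, b'}, {b, c'}, {c, d'}, {d, a'}} \<union> {{a, a'}, {b, b'}, {c, c'}, {d, d'}}"
    unfolding insert_commute[of a' a] insert_commute[of d' d] insert_commute[of c' c]
      insert_commute[of b' b]
    by (simp only: Un_insert_left Un_empty_left insert_commute)
  finally have eq: "cycle_edges [a, b', b, c', c, d', d, a'] =
      {{a, b'}, {b, c'}, {c, d'}, {d, a'}} \<union> {{a, a'}, {b, b'}, {c, c'}, {d, d'}}" .
  then have "cycle_edges [a, b', b, c', c, d', d, a'] \<inter> M = {{a, a'}, {b, b'}, {c, c'}, {d, d'}}"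
    using assms(2,3)
    by (simp only: Un_insert_left Un_empty_left insert_subset Diff_iff Int_iff Int_insert_left
        Int_empty_left simp_thms if_True if_False)
  moreover have "card {{a, a'}, {b, b'}, {c, c'}, {d, d'}} = 4"
    using assms(1) by (simp add: doubleton_eq_iff)
  moreover have "cycle_edges [a, b', b, c', c, d', d, a'] \<subseteq> E" unfolding eq using assms(2,3) by simp
  ultimately show ?thesis
    using assms(1) unfolding is_M_cycle_def is_cycle_def by simp
qed

section \<open>Contraction of the perfect matching to a digraph\<close>

locale matched_bipartite =
  fixes X Y :: "'a set" and E M :: "'a set set" and \<mu> :: "'a \<Rightarrow> 'a"
  assumes bip: "bipartite_graph X Y E"
    and inj: "inj_on \<mu> X" and img: "\<mu> ` X = Y"
    and mate: "x \<in> X \<Longrightarrow> {x, \<mu> x} \<in> M" and ME: "M \<subseteq> E"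
    and mate_unique: "\<lbrakk>x \<in> X; e \<in> M; x \<in> e\<rbrakk> \<Longrightarrow> e = {x, \<mu> x}"
begin

definition arc :: "'a \<Rightarrow> 'a \<Rightarrow> bool" where
  "arc x x' \<longleftrightarrow> x \<in> X \<and> x' \<in> X \<and> x \<noteq> x' \<and> {x, \<mu> x'} \<in> E"

lemma finite_X: "finite X" and XY: "X \<inter> Y = {}"
  using bip by (auto simp: bipartite_graph_def)

lemma E_elem: "e \<in> E \<Longrightarrow> \<exists>x\<in>X. \<exists>x'\<in>X. e = {x, \<mu> x'}"
  using bip img unfolding bipartite_graph_def by blast

lemma mu_notin: "x \<in> X \<Longrightarrow> \<mu> x \<notin> X"
  using img XY by blast

lemma edge_cases: "\<lbrakk>{v, w} \<in> E; v \<in> X\<rbrakk> \<Longrightarrow> \<exists>x\<in>X. w = \<mu> x"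
  using E_elem[of "{v, w}"] mu_notin by (auto simp: doubleton_eq_iff)

text \<open>The successor accounts for the matching edge at \<open>x\<close>, which would be a loop
  and is excluded from \<open>arc\<close>.\<close>

lemma degree_X:
  assumes "x \<in> X" shows "degree E x = Suc (outdeg arc x X)"
proof -
  have "{u. {x, u} \<in> E} = \<mu> ` insert x {w \<in> X. arc x w}"
    using assms edge_cases[of x] mate[of x] ME by (auto simp: arc_def)
  moreover have "inj_on \<mu> (insert x {w \<in> X. arc x w})"
    using inj by (rule inj_on_subset) (use assms in auto)
  ultimately have "degree E x = card (insert x {w \<in> X. arc x w})"
    by (simp only: degree_def card_image)
  then show ?thesis using finite_X by (simp add: outdeg_def arc_def)
qed

lemma degree_Y:
  assumes "x \<in> X" shows "degree E (\<mu> x) = Suc (indeg arc x X)"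
proof -
  have "u \<in> X" if "{\<mu> x, u} \<in> E" for u
    using E_elem[OF that] mu_notin[OF assms] by (auto simp: doubleton_eq_iff)
  then have "{u. {\<mu> x, u} \<in> E} = insert x {w \<in> X. arc w x}"
    using assms mate[of x] ME by (auto simp: arc_def insert_commute)
  then show ?thesis using finite_X by (simp add: degree_def outdeg_def arc_def)
qed

lemma arc_edge: "arc x x' \<Longrightarrow> {x, \<mu> x'} \<in> E - M"
  using mate_unique[of x "{x, \<mu> x'}"] inj mu_notin[of x]
  by (auto simp: arc_def doubleton_eq_iff inj_on_eq_iff)

lemma mate_edge: "x \<in> X \<Longrightarrow> {x, \<mu> x} \<in> E \<inter> M"
  using mate ME by auto

lemma M_cycle_of_dicycle:
  assumes "C \<subseteq> X" "dicycle3 arc C \<or> dicycle4 arc C"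
  shows "\<exists>c. set c = C \<union> \<mu> ` C \<and> is_M_cycle E M c \<and> (length c = 6 \<or> length c = 8)"
  using assms(2)
proof
  assume "dicycle3 arc C"
  then obtain a b c where abc: "C = {a, b, c}" "distinct [a, b, c]" "arc a b" "arc b c" "arc c a"
    unfolding dicycle3_def by blast
  then have X: "a \<in> X" "b \<in> X" "c \<in> X" using assms(1) by auto
  have ne: "x \<noteq> \<mu> z" if "x \<in> X" "z \<in> X" for x z using mu_notin that by blast
  have "distinct [a, \<mu> b, b, \<mu> c, c, \<mu> a]"
    using abc(2) X inj ne ne[symmetric] by (auto simp: inj_on_eq_iff)
  then have "is_M_cycle E M [a, \<mu> b, b, \<mu> c, c, \<mu> a]"
    using abc X by (intro is_M_cycle_6) (simp_all only: insert_subset arc_edge mate_edge empty_subsetI simp_thms)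
  then show ?thesis by (intro exI[of _ "[a, \<mu> b, b, \<mu> c, c, \<mu> a]"]) (auto simp: abc(1))
next
  assume "dicycle4 arc C"
  then obtain a b c d where abc: "C = {a, b, c, d}" "distinct [a, b, c, d]"
      "arc a b" "arc b c" "arc c d" "arc d a"
    unfolding dicycle4_def by blast
  then have X: "a \<in> X" "b \<in> X" "c \<in> X" "d \<in> X" using assms(1) by auto
  have ne: "x \<noteq> \<mu> z" if "x \<in> X" "z \<in> X" for x z using mu_notin that by blast
  have "distinct [a, \<mu> b, b, \<mu> c, c, \<mu> d, d, \<mu> a]"
    using abc(2) X inj ne ne[symmetric] by (auto simp: inj_on_eq_iff)
  then have "is_M_cycle E M [a, \<mu> b, b, \<mu> c, c, \<mu> d, d, \<mu> a]"
    using abc X by (intro is_M_cycle_8) (simp_all only: insert_subset arc_edge mate_edge empty_subsetI simp_thms)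
  then show ?thesis by (intro exI[of _ "[a, \<mu> b, b, \<mu> c, c, \<mu> d, d, \<mu> a]"]) (auto simp: abc(1))
qed

text \<open>Disjointness survives the expansion because \<open>\<mu>\<close> is injective and maps
  \<open>X\<close> outside \<open>X\<close>.\<close>

lemma M_cycle_list_of_packing:
  assumes F: "packing arc X F"
  shows "\<exists>Cs. length Cs = card F \<and>
    (\<forall>C\<in>set Cs. is_M_cycle E M C \<and> (length C = 6 \<or> length C = 8)) \<and>
    (\<forall>i < card F. \<forall>j < card F. i \<noteq> j \<longrightarrow> set (Cs ! i) \<inter> set (Cs ! j) = {})"
proof -
  have FX: "C \<subseteq> X" if "C \<in> F" for C using F that unfolding packing_def by auto
  have "\<forall>C\<in>F. \<exists>c. set c = C \<union> \<mu> ` C \<and> is_M_cycle E M c \<and> (length c = 6 \<or> length c = 8)"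
    using M_cycle_of_dicycle FX F unfolding packing_def by blast
  then obtain f where f: "\<And>C. C \<in> F \<Longrightarrow> set (f C) = C \<union> \<mu> ` C"
      "\<And>C. C \<in> F \<Longrightarrow> is_M_cycle E M (f C) \<and> (length (f C) = 6 \<or> length (f C) = 8)"
    by metis
  have "finite F" using F finite_X unfolding packing_def by (meson finite_Pow_iff finite_subset)
  then obtain Fs where Fs: "set Fs = F" "distinct Fs" using finite_distinct_list by blast
  then have len: "length Fs = card F" using distinct_card by fastforce
  have disj: "set (f C) \<inter> set (f D) = {}" if "C \<in> F" "D \<in> F" "C \<noteq> D" for C D
  proof -
    have CD: "C \<inter> D = {}" using F that unfolding packing_def pairwise_def disjnt_def by blast
    then have "\<mu> ` C \<inter> \<mu> ` D = {}"
      using inj_on_image_Int[OF inj FX[OF that(1)] FX[OF that(2)]] by simp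
    moreover have "\<mu> ` C \<inter> D = {}" "C \<inter> \<mu> ` D = {}"
      using mu_notin FX that by blast+
    ultimately show ?thesis
      unfolding f(1)[OF that(1)] f(1)[OF that(2)] using CD by (simp add: Int_Un_distrib Int_Un_distrib2)
  qed
  show ?thesis
  proof (intro exI[of _ "map f Fs"] conjI allI impI)
    show "set (map f Fs ! i) \<inter> set (map f Fs ! j) = {}"
      if "i < card F" "j < card F" "i \<noteq> j" for i j
    proof -
      have ij: "i < length Fs" "j < length Fs" using that len by simp_all
      then have "Fs ! i \<noteq> Fs ! j" using Fs(2) that(3) by (simp add: nth_eq_iff_index_eq)
      moreover have "Fs ! i \<in> F" "Fs ! j \<in> F" using ij Fs(1) nth_mem by blast+
      ultimately show ?thesis using disj ij by simp
    qed
  qed (use len f(2) Fs in auto)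
qed

end

text \<open>Choosing partners gives a map from \<open>X\<close> to \<open>Y\<close>, injective by
  uniqueness of the matching edge at a vertex of \<open>Y\<close> and onto because \<open>X\<close>
  and \<open>Y\<close> have equal size.\<close>

lemma matched_bipartite_exists:
  assumes bip: "bipartite_graph X Y E" and card: "card X = card Y"
    and pm: "perfect_matching (X \<union> Y) E M"
  shows "\<exists>\<mu>. matched_bipartite X Y E M \<mu>"
proof -
  have fin: "finite X" "finite Y" and XY: "X \<inter> Y = {}"
    and E: "\<And>e. e \<in> E \<Longrightarrow> \<exists>x\<in>X. \<exists>y\<in>Y. e = {x, y}"
    using bip unfolding bipartite_graph_def by blast+
  have ME: "M \<subseteq> E" and ex: "\<And>v. v \<in> X \<union> Y \<Longrightarrow> \<exists>e\<in>M. v \<in> e"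
    and uniq: "\<And>v e e'. \<lbrakk>v \<in> X \<union> Y; e \<in> M; v \<in> e; e' \<in> M; v \<in> e'\<rbrakk> \<Longrightarrow> e = e'"
    using pm unfolding perfect_matching_def by blast+
  have "\<forall>x\<in>X. \<exists>y\<in>Y. {x, y} \<in> M"
  proof
    fix x assume x: "x \<in> X"
    then obtain e where e: "e \<in> M" "x \<in> e" using ex by blast
    then obtain x' y where "x' \<in> X" "y \<in> Y" "e = {x', y}" using E ME by blast
    then show "\<exists>y\<in>Y. {x, y} \<in> M" using e x XY by blast
  qed
  then obtain \<mu> where \<mu>: "\<And>x. x \<in> X \<Longrightarrow> \<mu> x \<in> Y" "\<And>x. x \<in> X \<Longrightarrow> {x, \<mu> x} \<in> M"
    by metis
  have inj: "inj_on \<mu> X"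
  proof (rule inj_onI)
    fix x x' assume x: "x \<in> X" "x' \<in> X" "\<mu> x = \<mu> x'"
    have "{x, \<mu> x} = {x', \<mu> x'}"
      by (rule uniq[of "\<mu> x"]) (use \<mu>(1)[OF x(1)] \<mu>(2)[OF x(1)] \<mu>(2)[OF x(2)] x(3) in simp_all)
    then show "x = x'" using x by (auto simp: doubleton_eq_iff)
  qed
  have "\<mu> ` X = Y"
    by (rule card_subset_eq[OF fin(2)]) (use \<mu>(1) card_image[OF inj] card in auto)
  then have "matched_bipartite X Y E M \<mu>"
  proof unfold_locales
    show "e = {x, \<mu> x}" if "x \<in> X" "e \<in> M" "x \<in> e" for x e
      by (rule uniq[of x]) (use \<mu>(2)[OF that(1)] that in simp_all)
  qed (use bip inj \<mu>(2) ME in simp_all)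
  then show ?thesis by blast
qed

theorem theorem3:
  fixes X Y :: "'a set" and E M :: "'a set set" and n k :: nat
  assumes "k \<ge> 1"
    and "bipartite_graph X Y E"
    and "card X = n" and "card Y = n"
    and "perfect_matching (X \<union> Y) E M"
    and "n \<ge> 12 * k - 9"
    and "sigma11 X Y E \<ge> enat (n + 2)"
  shows "\<exists>Cs :: 'a list list. length Cs = k \<and>
           (\<forall>C \<in> set Cs. is_M_cycle E M C \<and> (length C = 6 \<or> length C = 8)) \<and>
           (\<forall>i < k. \<forall>j < k. i \<noteq> j \<longrightarrow> set (Cs ! i) \<inter> set (Cs ! j) = {})"
proof -
  obtain \<mu> where "matched_bipartite X Y E M \<mu>"
    using matched_bipartite_exists[of X Y E M] assms by auto
  then interpret matched_bipartite X Y E M \<mu> .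
  have "\<exists>F. packing arc X F \<and> card F = k"
  proof (rule disjoint_short_dicycles)
    show "finite X" by (rule finite_X)
    show "\<not> arc a a" for a by (simp add: arc_def)
    show "12 * k \<le> card X + 9" using assms by simp
    fix a b assume ab: "a \<in> X" "b \<in> X" "a \<noteq> b" "\<not> arc a b"
    then have "{a, \<mu> b} \<notin> E" "\<mu> b \<in> Y" using img by (auto simp: arc_def)
    then have "sigma11 X Y E \<le> enat (degree E a + degree E (\<mu> b))"
      unfolding sigma11_def using ab by (intro INF_lower2[of "(a, \<mu> b)"]) auto
    with assms(7) have "enat (n + 2) \<le> enat (degree E a + degree E (\<mu> b))"
      by (rule order_trans)
    \<comment> \<open>The summand 2 in the degree hypothesis is used up by the matching edges at
      \<open>a\<close> and at \<open>\<mu> b\<close>.\<close>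
    then show "card X \<le> outdeg arc a X + indeg arc b X"
      using degree_X[OF ab(1)] degree_Y[OF ab(2)] assms(3) by simp
  qed
  then obtain F where "packing arc X F" "card F = k" by blast
  then show ?thesis using M_cycle_list_of_packing by blast
qed

end
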